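(* Let $n = r+\delta$ with integers $0<\delta<r$. If $P$ is chosen uniformly at random from the $2^{n-1}$ polynomials in $\mathbb{Z}_2[x]$ of degree $n$ with $P(0)\neq 0$, then the probability that $P$ is almost irreducible with exponent $r$ is $\frac{1}{r}\left(1+O(2^{-r/2})\right)$.
   Context: $\mathbb{Z}_2 = \mathrm{GF}(2)$ is the field with two elements. A polynomial $P \in \mathbb{Z}_2[x]$ of degree $n$ is almost irreducible if $P(0)\neq 0$ and $P$ has an irreducible factor of degree $r$ for some $r > n/2$; one then says that $P$ has exponent $r$ and increment $n-r$. The constant implied by $O$ is absolute (independent of $r$ and $\delta$). *)

theory Defs
  imports
    "HOL-Probability.Probability"
    "HOL-Computational_Algebra.Computational_Algebra"
    "HOL-Library.Z2"
begin

text \<open>The field with two elements is the type \<^typ>\<open>bit\<close>. The exponent is given as a relation;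
  since \<open>r > n / 2\<close>, each \<open>P\<close> has at most one exponent.\<close>

definition almost_irreducible_with_exponent :: "bit poly \<Rightarrow> nat \<Rightarrow> bool" where
  "almost_irreducible_with_exponent P r \<longleftrightarrow>
     poly P 0 \<noteq> 0 \<and> real r > real (degree P) / 2 \<and>
     (\<exists>Q. irreducible Q \<and> Q dvd P \<and> degree Q = r)"

definition polys_nonzero_const :: "nat \<Rightarrow> bit poly set" where
  "polys_nonzero_const n = {P. degree P = n \<and> poly P 0 \<noteq> 0}"

lemma card_polys_nonzero_const:
  assumes "n > 0"
  shows "card (polys_nonzero_const n) = 2 ^ (n - 1)"
proof -
  have UNIV_bit: "(UNIV :: bit set) = {0, 1}"
    using bit.exhaust by blast
  define L where "L = {xs :: bit list. set xs \<subseteq> UNIV \<and> length xs = n - 1}"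
  define f where "f xs = Poly (1 # xs @ [1])" for xs :: "bit list"
  have co: "coeffs (f xs) = 1 # xs @ [1]" for xs
    proof -
    have "strip_while ((=) 0) ((1 # xs) @ [1 :: bit]) = (1 # xs) @ [1]"
      by (subst strip_while_append) simp_all
    then show ?thesis
      by (simp only: f_def coeffs_Poly append_Cons)
  qed
  have "bij_betw f L (polys_nonzero_const n)"
  proof (rule bij_betw_imageI)
    show "inj_on f L"
      using co by (intro inj_onI) (metis append_same_eq list.inject)
    show "f ` L = polys_nonzero_const n"
    proof (intro equalityI subsetI)
      fix P assume "P \<in> f ` L"
      then obtain xs where xs: "length xs = n - 1" "P = f xs"
        by (auto simp: L_def)
      have "degree P = n"
        using xs co[of xs] assms by (simp add: degree_eq_length_coeffs)
      moreover have "poly P 0 = 1"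
        using xs by (simp add: f_def)
      ultimately show "P \<in> polys_nonzero_const n"
        by (simp add: polys_nonzero_const_def)
    next
      fix P assume "P \<in> polys_nonzero_const n"
      then have P: "degree P = n" "poly P 0 = 1"
        by (auto simp: polys_nonzero_const_def)
      then have "P \<noteq> 0" by auto
      then have len: "length (coeffs P) = n + 1"
        using P by (simp add: length_coeffs_degree)
      have last: "last (coeffs P) = 1"
        using \<open>P \<noteq> 0\<close> by (simp add: last_coeffs_eq_coeff_degree flip: bit_not_zero_iff)
      have "hd (coeffs P) = 1"
        using P len \<open>P \<noteq> 0\<close>
        by (cases P) (auto simp: cCons_def split: if_splits)
      with len obtain ys where ys: "coeffs P = 1 # ys" "length ys = n"
        by (cases "coeffs P") auto
      moreover obtain zs where "ys = zs @ [1]"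
        using ys last assms by (cases ys rule: rev_cases) auto
      ultimately have "coeffs P = 1 # zs @ [1]" "zs \<in> L"
        by (auto simp: L_def)
      then show "P \<in> f ` L"
        by (metis co coeffs_eq_iff imageI)
    qed
  qed
  then have "card (polys_nonzero_const n) = card L"
    by (simp add: bij_betw_same_card)
  also have "\<dots> = card (UNIV :: bit set) ^ (n - 1)"
    unfolding L_def by (rule card_lists_length_eq) (simp add: UNIV_bit)
  also have "\<dots> = 2 ^ (n - 1)"
    by (simp add: UNIV_bit numeral_2_eq_2)
  finally show ?thesis .
qed

end

theory Submission
  imports Defs
begin

text \<open>Let \<open>I\<^sub>d\<close> be the number of irreducible polynomials of degree \<open>d\<close>. By unique factorization,
  \<open>P\<close> has exponent \<open>r\<close> iff it is uniquely a product of an irreducible polynomial of degree \<open>r\<close> and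
  a polynomial of degree \<open>\<delta>\<close> with nonzero constant term, so the probability is \<open>I\<^sub>r / 2\<^sup>r\<close>.
  Counting the degrees of all \<open>2\<^sup>n\<close> polynomials of degree \<open>n\<close> through the prime powers dividing them
  gives a recurrence whose solution is Gauss's identity that the \<open>d I\<^sub>d\<close> with \<open>d\<close> dividing \<open>n\<close> sum
  to \<open>2\<^sup>n\<close>; the terms with \<open>d < r\<close> have \<open>d \<le> r / 2\<close> and contribute less than
  \<open>2 \<cdot> 2\<^bsup>r/2\<^esup>\<close>.\<close>

section \<open>Units and irreducible polynomials over GF(2)\<close>

lemma UNIV_bit: "(UNIV :: bit set) = {0, 1}"
  using bit.exhaust by blast

lemma is_unit_bit_poly: "is_unit p \<longleftrightarrow> p = 1" for p :: "bit poly"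
  by (auto simp: is_unit_poly_iff dvd_field_iff)

text \<open>The cofactor must be a unit, and the only unit over GF(2) is 1, so associated
  irreducibles coincide.\<close>

lemma irreducible_bit_poly_dvd_eq:
  fixes p q :: "bit poly"
  assumes "irreducible p" "irreducible q" "p dvd q"
  shows "p = q"
proof -
  obtain c where c: "q = p * c"
    using assms(3) by (auto elim: dvdE)
  then have "is_unit p \<or> is_unit c"
    using assms(2) by (rule irreducibleD[rotated])
  then show ?thesis
    using assms(1) c by (auto simp: is_unit_bit_poly)
qed

text \<open>Over a field, the nonunit factors of a reducible polynomial are nonconstant and hence of
  smaller degree, so strong induction on the degree applies.\<close>

lemma irreducible_poly_divisor_exists:
  fixes f :: "'a::field poly"
  assumes "degree f > 0"
  shows "\<exists>p. irreducible p \<and> p dvd f"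
  using assms
proof (induction "degree f" arbitrary: f rule: less_induct)
  case less
  show ?case
  proof (cases "irreducible f")
    case False
    have "f \<noteq> 0" using less.prems by auto
    moreover from this have "\<not> is_unit f"
      using less.prems is_unit_iff_degree[of f] by simp
    moreover note False
    ultimately obtain a b where ab: "f = a * b" "\<not> is_unit a" "\<not> is_unit b"
      by (auto simp: irreducible_def)
    with \<open>f \<noteq> 0\<close> have "a \<noteq> 0" "b \<noteq> 0" by auto
    then have "degree a > 0" "degree b > 0"
      using ab is_unit_iff_degree by blast+
    moreover have "degree f = degree a + degree b"
      using \<open>a \<noteq> 0\<close> \<open>b \<noteq> 0\<close> ab by (simp add: degree_mult_eq)
    ultimately obtain p where "irreducible p" "p dvd a"
      using less.hyps[of a] by auto
    then show ?thesis
      using ab by auto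
  qed auto
qed

lemma irreducible_poly_degree_pos: "irreducible p \<Longrightarrow> degree p > 0" for p :: "'a::field poly"
  by (metis gr0I irreducible_def is_unit_iff_degree)

section \<open>Counting polynomials and multiples by degree\<close>

lemma bit_polys_of_degree:
  shows finite_bit_polys_of_degree: "finite {p :: bit poly. p \<noteq> 0 \<and> degree p = n}"
    and card_bit_polys_of_degree: "card {p :: bit poly. p \<noteq> 0 \<and> degree p = n} = 2 ^ n"
proof (induction n)
  case 0
  have "{p :: bit poly. p \<noteq> 0 \<and> degree p = 0} = {1}"
    using is_unit_iff_degree[where ?'a = bit] by (intro set_eqI) (auto simp: is_unit_bit_poly)
  then show "finite {p :: bit poly. p \<noteq> 0 \<and> degree p = 0}"
    and "card {p :: bit poly. p \<noteq> 0 \<and> degree p = 0} = 2 ^ 0"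
    by simp_all
next
  case (Suc n)
  let ?A = "\<lambda>n. {p :: bit poly. p \<noteq> 0 \<and> degree p = n}"
  \<comment> \<open>The constant coefficient is free and the others form a polynomial of degree
    \<open>n\<close>, so the count doubles.\<close>
  have img: "?A (Suc n) = (\<lambda>(c, p). pCons c p) ` (UNIV \<times> ?A n)"
  proof (intro equalityI subsetI)
    fix p assume p: "p \<in> ?A (Suc n)"
    obtain c q where cq: "p = pCons c q" by (cases p)
    with p have "q \<in> ?A n" by (auto split: if_splits)
    with cq show "p \<in> (\<lambda>(c, p). pCons c p) ` (UNIV \<times> ?A n)" by auto
  qed auto
  have "inj_on (\<lambda>(c, p). pCons c p) (UNIV \<times> ?A n)"
    by (auto simp: inj_on_def)
  then have "card (?A (Suc n)) = card ((UNIV :: bit set) \<times> ?A n)"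
    unfolding img by (rule card_image)
  then show "card (?A (Suc n)) = 2 ^ Suc n"
    using Suc by (simp add: card_cartesian_product UNIV_bit)
  show "finite (?A (Suc n))"
    unfolding img using Suc by (simp add: UNIV_bit)
qed

lemma finite_bit_polys_degree_le: "finite {p :: bit poly. degree p \<le> n}"
proof -
  have "{p :: bit poly. degree p \<le> n} \<subseteq> insert 0 (\<Union>k\<le>n. {p. p \<noteq> 0 \<and> degree p = k})"
    by auto
  then show ?thesis
    by (rule finite_subset) (use finite_bit_polys_of_degree in auto)
qed

lemma card_bit_poly_multiples:
  fixes q :: "bit poly"
  assumes "q \<noteq> 0" "degree q \<le> n"
  shows "card {f. f \<noteq> 0 \<and> degree f = n \<and> q dvd f} = 2 ^ (n - degree q)"
proof -
  have "{f. f \<noteq> 0 \<and> degree f = n \<and> q dvd f} = (*) q ` {g. g \<noteq> 0 \<and> degree g = n - degree q}"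
    using assms by (auto simp: degree_mult_eq elim!: dvdE)
  moreover have "inj_on ((*) q) A" for A
    using assms by (auto simp: inj_on_def)
  ultimately show ?thesis
    by (simp add: card_image card_bit_polys_of_degree)
qed

section \<open>Multiplicities of irreducible factors and Gauss's identity\<close>

lemma power_dvd_imp_le_degree:
  fixes p f :: "'a::field poly"
  assumes "degree p > 0" "p ^ k dvd f" "f \<noteq> 0"
  shows "k \<le> degree f"
proof -
  have "k * degree p \<le> degree f"
    using dvd_imp_degree_le[OF assms(2,3)] assms(1) by (subst (asm) degree_power_eq) auto
  moreover have "k * 1 \<le> k * degree p"
    using assms(1) by (intro mult_le_mono) auto
  ultimately show ?thesis by linarith
qed

text \<open>The inner cardinality is the multiplicity of \<open>p\<close> in \<open>f\<close>; the library's \<open>multiplicity\<close> needs a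
  \<^class>\<open>factorial_semiring\<close>, and \<^typ>\<open>bit poly\<close> is not an instance of that class.\<close>

lemma degree_eq_sum_irreducible_powers:
  fixes f :: "bit poly"
  assumes "f \<noteq> 0" "degree f \<le> n"
  shows "degree f = (\<Sum>p | irreducible p \<and> degree p \<le> n.
           degree p * card {k \<in> {1..n}. p ^ k dvd f})"
  using assms
proof (induction "degree f" arbitrary: f rule: less_induct)
  case less
  let ?I = "{p :: bit poly. irreducible p \<and> degree p \<le> n}"
  let ?m = "\<lambda>p f :: bit poly. card {k \<in> {1..n}. p ^ k dvd f}"
  have finI: "finite ?I"
    by (rule finite_subset[OF _ finite_bit_polys_degree_le[of n]]) auto
  show ?case
  proof (cases "degree f = 0")
    case True
    have "{k \<in> {1..n}. p ^ k dvd f} = {}" if "irreducible p" for p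
      using power_dvd_imp_le_degree[of p _ f] irreducible_poly_degree_pos[OF that] True less.prems
      by auto
    then have "(\<Sum>p\<in>?I. degree p * ?m p f) = 0"
      by (intro sum.neutral) (metis card.empty mem_Collect_eq mult_0_right)
    with True show ?thesis by simp
  next
    case False
    \<comment> \<open>Splitting off one irreducible factor \<open>p\<close> raises the multiplicity
      of \<open>p\<close> by one and leaves all others unchanged.\<close>
    then obtain p g where p: "irreducible p" and f: "f = p * g"
      using irreducible_poly_divisor_exists[of f] by (auto elim!: dvdE)
    have "p \<noteq> 0" "g \<noteq> 0" using f less.prems by auto
    have dp: "degree p > 0" by (rule irreducible_poly_degree_pos[OF p])
    have deg: "degree f = degree p + degree g"
      using f \<open>p \<noteq> 0\<close> \<open>g \<noteq> 0\<close> by (simp add: degree_mult_eq)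
    \<comment> \<open>Cancelling one \<open>p\<close> shifts the exponents by one. The cutoff
      \<open>n\<close> loses nothing, because an exponent is at most
      \<open>degree f\<close>.\<close>
    have "{k \<in> {1..n}. p ^ k dvd f} = insert 1 (Suc ` {k \<in> {1..n}. p ^ k dvd g})"
    proof (intro equalityI subsetI)
      fix k assume k: "k \<in> {k \<in> {1..n}. p ^ k dvd f}"
      then obtain j where j: "k = Suc j" by (cases k) auto
      with k f \<open>p \<noteq> 0\<close> have "p ^ j dvd g" by simp
      with k j show "k \<in> insert 1 (Suc ` {k \<in> {1..n}. p ^ k dvd g})"
        by (cases "j = 0") auto
    next
      fix k assume "k \<in> insert 1 (Suc ` {k \<in> {1..n}. p ^ k dvd g})"
      then consider "k = 1" | j where "k = Suc j" "p ^ j dvd g" by auto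
      then have "p ^ k dvd f" "k \<ge> 1"
        using f by (cases; auto)+
      then show "k \<in> {k \<in> {1..n}. p ^ k dvd f}"
        using power_dvd_imp_le_degree[OF dp, of k f] less.prems by auto
    qed
    then have mp: "?m p f = Suc (?m p g)"
      by (simp add: card_image card_insert_if image_iff)
    have mq: "?m q f = ?m q g" if q: "irreducible q" "q \<noteq> p" for q
    proof -
      have "prime_elem q" by (rule field_poly_irreducible_imp_prime[OF q(1)])
      have "q ^ k dvd g" if k: "q ^ k dvd f" for k
      proof -
        \<comment> \<open>A prime power dividing \<open>p * g\<close> splits between the two
          factors; the share of \<open>p\<close> is trivial since \<open>q\<close> does not divide
          \<open>p\<close>.\<close>
        obtain i j where ij: "i + j = k" "q ^ i dvd p" "q ^ j dvd g"
          using prime_elem_power_dvd_prod[OF _ \<open>prime_elem q\<close>, of k p g] k f by auto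
        have "\<not> q dvd p"
          using irreducible_bit_poly_dvd_eq q p by blast
        then have "i = 0"
          using ij(2) by (metis dvd_power dvd_trans gr0I)
        with ij show ?thesis by simp
      qed
      then show ?thesis
        using f by (metis dvd_mult)
    qed
    have pI: "p \<in> ?I" using p deg less.prems by auto
    have "(\<Sum>q\<in>?I. degree q * ?m q f) = degree p * ?m p f + (\<Sum>q\<in>?I - {p}. degree q * ?m q f)"
      by (rule sum.remove[OF finI pI])
    also have "(\<Sum>q\<in>?I - {p}. degree q * ?m q f) = (\<Sum>q\<in>?I - {p}. degree q * ?m q g)"
      by (rule sum.cong) (use mq in auto)
    also have "degree p * ?m p f + (\<Sum>q\<in>?I - {p}. degree q * ?m q g) =
        degree p + (\<Sum>q\<in>?I. degree q * ?m q g)"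
      unfolding sum.remove[OF finI pI] mp by (simp only: mult_Suc_right add.assoc)
    also have "(\<Sum>q\<in>?I. degree q * ?m q g) = degree g"
      using less.hyps[of g] less.prems deg dp \<open>g \<noteq> 0\<close> by simp
    finally show ?thesis using deg by simp
  qed
qed

text \<open>Double counting of the total degree of the \<open>2 ^ n\<close> polynomials of degree
  \<open>n\<close>: write each degree as a sum over irreducible powers and swap the sums. If
  \<open>k * degree p \<le> n\<close>, then \<open>p ^ k\<close> divides exactly
  \<open>2 ^ (n - k * degree p)\<close> of them; finally collect the terms by
  \<open>m = k * degree p\<close>.\<close>

lemma sum_degree_bit_polys:
  "n * 2 ^ n = (\<Sum>m=1..n. 2 ^ (n - m) *
     (\<Sum>p :: bit poly | irreducible p \<and> degree p dvd m. degree p))"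
proof -
  let ?I = "{p :: bit poly. irreducible p \<and> degree p \<le> n}"
  let ?F = "{f :: bit poly. f \<noteq> 0 \<and> degree f = n}"
  have finI: "finite ?I"
    by (rule finite_subset[OF _ finite_bit_polys_degree_le[of n]]) auto
  note finF = finite_bit_polys_of_degree[of n]
  have count: "(\<Sum>f\<in>?F. card {k \<in> {1..n}. p ^ k dvd f}) = (\<Sum>m | m \<in> {1..n} \<and> degree p dvd m. 2 ^ (n - m))"
    if p: "p \<in> ?I" for p
  proof -
    have dp: "degree p > 0" "p \<noteq> 0" using p irreducible_poly_degree_pos by auto
    have "(\<Sum>f\<in>?F. card {k \<in> {1..n}. p ^ k dvd f}) = (\<Sum>f\<in>?F. \<Sum>k=1..n. of_bool (p ^ k dvd f))"
      by (simp add: Int_def)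
    also have "\<dots> = (\<Sum>k=1..n. \<Sum>f\<in>?F. of_bool (p ^ k dvd f))"
      by (rule sum.swap)
    also have "\<dots> = (\<Sum>k=1..n. card {f \<in> ?F. p ^ k dvd f})"
      using finF by (simp add: Int_def)
    also have "\<dots> = (\<Sum>k | k \<in> {1..n} \<and> k * degree p \<le> n. 2 ^ (n - k * degree p))"
    proof (rule sum.mono_neutral_cong_right)
      \<comment> \<open>Here \<open>p ^ k\<close> has degree above \<open>n\<close>, so it divides
        none of the polynomials.\<close>
      show "\<forall>k\<in>{1..n} - {k. k \<in> {1..n} \<and> k * degree p \<le> n}. card {f \<in> ?F. p ^ k dvd f} = 0"
      proof
        fix k assume k: "k \<in> {1..n} - {k. k \<in> {1..n} \<and> k * degree p \<le> n}"
        have "{f \<in> ?F. p ^ k dvd f} = {}"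
          using k dp by (auto dest!: dvd_imp_degree_le simp: degree_power_eq)
        then show "card {f \<in> ?F. p ^ k dvd f} = 0" by (simp only: card.empty)
      qed
      fix k assume "k \<in> {k. k \<in> {1..n} \<and> k * degree p \<le> n}"
      then show "card {f \<in> ?F. p ^ k dvd f} = 2 ^ (n - k * degree p)"
        using card_bit_poly_multiples[of "p ^ k" n] dp by (simp add: degree_power_eq conj_assoc)
    qed auto
    also have "\<dots> = (\<Sum>m | m \<in> {1..n} \<and> degree p dvd m. 2 ^ (n - m))"
    proof (rule sum.reindex_bij_witness[of _ "\<lambda>m. m div degree p" "\<lambda>k. k * degree p"])
      fix m assume "m \<in> {m. m \<in> {1..n} \<and> degree p dvd m}"
      then show "m div degree p \<in> {k. k \<in> {1..n} \<and> k * degree p \<le> n}"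
        using dp by (auto elim!: dvdE intro: order_trans[rotated])
    qed (use dp in auto)
    finally show ?thesis .
  qed
  have "n * 2 ^ n = (\<Sum>f\<in>?F. degree f)"
    by (simp add: card_bit_polys_of_degree)
  also have "\<dots> = (\<Sum>f\<in>?F. \<Sum>p\<in>?I. degree p * card {k \<in> {1..n}. p ^ k dvd f})"
    by (rule sum.cong[OF refl], rule degree_eq_sum_irreducible_powers) auto
  also have "\<dots> = (\<Sum>p\<in>?I. degree p * (\<Sum>f\<in>?F. card {k \<in> {1..n}. p ^ k dvd f}))"
    by (subst sum.swap) (simp add: sum_distrib_left)
  also have "\<dots> = (\<Sum>p\<in>?I. \<Sum>m | m \<in> {1..n} \<and> degree p dvd m. 2 ^ (n - m) * degree p)"
    using count by (simp add: sum_distrib_left mult.commute)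
  also have "\<dots> = (\<Sum>m=1..n. \<Sum>p | p \<in> ?I \<and> degree p dvd m. 2 ^ (n - m) * degree p)"
    by (rule sum.swap_restrict[OF finI]) simp
  also have "\<dots> = (\<Sum>m=1..n. 2 ^ (n - m) * (\<Sum>p :: bit poly | irreducible p \<and> degree p dvd m. degree p))"
  proof (rule sum.cong[OF refl])
    fix m assume "m \<in> {1..n}"
    then have "{p. p \<in> ?I \<and> degree p dvd m} = {p :: bit poly. irreducible p \<and> degree p dvd m}"
      by (auto dest: dvd_imp_le)
    then show "(\<Sum>p | p \<in> ?I \<and> degree p dvd m. 2 ^ (n - m) * degree p) =
        2 ^ (n - m) * (\<Sum>p :: bit poly | irreducible p \<and> degree p dvd m. degree p)"
      by (simp add: sum_distrib_left)
  qed
  finally show ?thesis .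
qed

text \<open>Subtracting twice the recurrence at \<open>n - 1\<close> from the one at
  \<open>n\<close> cancels every term with \<open>m < n\<close>, and
  \<open>n * 2 ^ n - 2 * (n - 1) * 2 ^ (n - 1) = 2 ^ n\<close>.\<close>

lemma sum_degree_irreducible_bit_polys:
  assumes "n > 0"
  shows "(\<Sum>p :: bit poly | irreducible p \<and> degree p dvd n. degree p) = 2 ^ n"
proof -
  obtain l where l: "n = Suc l" using assms by (cases n) auto
  let ?a = "\<lambda>m. \<Sum>p :: bit poly | irreducible p \<and> degree p dvd m. degree p"
  have "Suc l * 2 ^ Suc l = (\<Sum>m=1..Suc l. 2 ^ (Suc l - m) * ?a m)"
    by (rule sum_degree_bit_polys)
  also have "\<dots> = (\<Sum>m=1..l. 2 * (2 ^ (l - m) * ?a m)) + ?a (Suc l)"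
    by (simp add: Suc_diff_le mult.assoc)
  also have "\<dots> = 2 * (l * 2 ^ l) + ?a (Suc l)"
    by (simp only: sum_degree_bit_polys[of l] sum_distrib_left)
  finally show ?thesis by (simp add: l)
qed

section \<open>Bounds for the number of irreducible polynomials\<close>

definition num_irreducible :: "nat \<Rightarrow> nat" where
  "num_irreducible r = card {p :: bit poly. irreducible p \<and> degree p = r}"

text \<open>Irreducibles of degree exactly \<open>r\<close> contribute only some of the nonnegative
  terms in Gauss's identity.\<close>

lemma num_irreducible_le:
  assumes "r > 0"
  shows "r * num_irreducible r \<le> 2 ^ r"
proof -
  have fin: "finite {p :: bit poly. irreducible p \<and> degree p dvd r}"
    by (rule finite_subset[OF _ finite_bit_polys_degree_le[of r]]) (use assms in \<open>auto dest: dvd_imp_le\<close>)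
  have "r * num_irreducible r = (\<Sum>p :: bit poly | irreducible p \<and> degree p = r. degree p)"
    by (simp add: num_irreducible_def)
  also have "\<dots> \<le> (\<Sum>p :: bit poly | irreducible p \<and> degree p dvd r. degree p)"
    by (rule sum_mono2[OF fin]) auto
  finally show ?thesis
    using sum_degree_irreducible_bit_polys[OF assms] by simp
qed

lemma num_irreducible_ge:
  assumes "r > 0"
  shows "2 ^ r \<le> r * num_irreducible r + 2 * 2 ^ (r div 2)"
proof -
  let ?P = "\<lambda>d. {p :: bit poly. irreducible p \<and> degree p = d}"
  have fin: "finite (?P d)" for d
    by (rule finite_subset[OF _ finite_bit_polys_degree_le[of d]]) auto
  have sumP: "(\<Sum>p\<in>?P d. degree p) = d * num_irreducible d" for d
    by (simp add: num_irreducible_def)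
  have half: "degree p \<in> {1..r div 2}"
    if "irreducible p" "degree p dvd r" "degree p \<noteq> r" for p :: "bit poly"
  proof -
    obtain k where k: "r = degree p * k" using \<open>degree p dvd r\<close> by (auto elim: dvdE)
    with that assms have "k \<ge> 2" by (cases k rule: nat.exhaust) auto
    then have "degree p * 2 \<le> r" using k by simp
    then show ?thesis using irreducible_poly_degree_pos[OF that(1)] by auto
  qed
  have "2 ^ r = (\<Sum>p :: bit poly | irreducible p \<and> degree p dvd r. degree p)"
    using sum_degree_irreducible_bit_polys[OF assms] by simp
  \<comment> \<open>Proper divisors of \<open>r\<close> are enlarged to all degrees up to
    \<open>r div 2\<close>. This is crude, but it keeps the error of order
    \<open>2 ^ (r div 2)\<close>.\<close>
  also have "\<dots> \<le> (\<Sum>p\<in>?P r \<union> (\<Union>d\<in>{1..r div 2}. ?P d). degree p)"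
    by (rule sum_mono2) (use fin half in blast)+
  also have "\<dots> \<le> (\<Sum>p\<in>?P r. degree p) + (\<Sum>p\<in>(\<Union>d\<in>{1..r div 2}. ?P d). degree p)"
    by (subst sum.union_inter[symmetric]) (use fin in auto)
  also have "(\<Sum>p\<in>(\<Union>d\<in>{1..r div 2}. ?P d). degree p) = (\<Sum>d=1..r div 2. \<Sum>p\<in>?P d. degree p)"
    by (rule sum.UNION_disjoint) (use fin in auto)
  also have "\<dots> \<le> (\<Sum>d=1..r div 2. 2 ^ d)"
    unfolding sumP by (rule sum_mono) (use num_irreducible_le in auto)
  \<comment> \<open>Adding the term \<open>d = 0\<close> gives a full geometric sum, equal to
    \<open>2 * 2 ^ (r div 2) - 1\<close>.\<close>
  also have "\<dots> \<le> (\<Sum>d<Suc (r div 2). 2 ^ d)"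
    by (rule sum_mono2) auto
  also have "\<dots> \<le> 2 * 2 ^ (r div 2)"
    using sum_power2[of "Suc (r div 2)"] by (simp add: lessThan_atLeast0)
  finally show ?thesis unfolding sumP by simp
qed

section \<open>Counting almost irreducible polynomials and the probability\<close>

lemma card_almost_irreducible:
  assumes "0 < \<delta>" "\<delta> < r"
  shows "card {P \<in> polys_nonzero_const (r + \<delta>). almost_irreducible_with_exponent P r} =
    num_irreducible r * 2 ^ (\<delta> - 1)"
proof -
  let ?I = "{Q :: bit poly. irreducible Q \<and> degree Q = r}"
  \<comment> \<open>The factorization is unique because an irreducible of degree \<open>r\<close>
    cannot divide a nonzero cofactor of degree \<delta> < r.\<close>
  have inj: "inj_on (\<lambda>(Q, S). Q * S) (?I \<times> polys_nonzero_const \<delta>)"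
  proof (rule inj_onI; clarify)
    fix Q S Q' S'
    assume Q: "irreducible Q" "irreducible Q'" "degree Q' = degree Q" "r = degree Q"
      and S: "S \<in> polys_nonzero_const \<delta>" "S' \<in> polys_nonzero_const \<delta>"
      and eq: "Q * S = Q' * S'"
    have "S' \<noteq> 0" "degree S' = \<delta>" using S by (auto simp: polys_nonzero_const_def)
    have "prime_elem Q" by (rule field_poly_irreducible_imp_prime[OF Q(1)])
    moreover have "Q dvd Q' * S'" using eq by (metis dvd_triv_left)
    ultimately have "Q dvd Q' \<or> Q dvd S'" by (rule prime_elem_dvd_multD)
    moreover have "\<not> Q dvd S'"
      using dvd_imp_degree_le[of Q S'] \<open>S' \<noteq> 0\<close> \<open>degree S' = \<delta>\<close> Q assms by auto
    ultimately have "Q = Q'"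
      using irreducible_bit_poly_dvd_eq[OF Q(1,2)] by blast
    with eq Q(1) show "Q = Q' \<and> S = S'" by (auto simp: irreducible_def)
  qed
  have "{P \<in> polys_nonzero_const (r + \<delta>). almost_irreducible_with_exponent P r} =
      (\<lambda>(Q, S). Q * S) ` (?I \<times> polys_nonzero_const \<delta>)"
  proof (intro equalityI subsetI)
    fix P assume "P \<in> {P \<in> polys_nonzero_const (r + \<delta>). almost_irreducible_with_exponent P r}"
    then obtain Q where P: "degree P = r + \<delta>" "poly P 0 \<noteq> 0"
      and Q: "irreducible Q" "degree Q = r" "Q dvd P"
      by (auto simp: polys_nonzero_const_def almost_irreducible_with_exponent_def)
    then obtain S where S: "P = Q * S" by (auto elim: dvdE)
    with P have "Q \<noteq> 0" "S \<noteq> 0" by auto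
    then have "S \<in> polys_nonzero_const \<delta>"
      using P Q S by (simp add: polys_nonzero_const_def degree_mult_eq)
    with Q S show "P \<in> (\<lambda>(Q, S). Q * S) ` (?I \<times> polys_nonzero_const \<delta>)" by auto
  next
    fix P assume "P \<in> (\<lambda>(Q, S). Q * S) ` (?I \<times> polys_nonzero_const \<delta>)"
    then obtain Q S where Q: "irreducible Q" "degree Q = r" and P: "P = Q * S"
      and S: "degree S = \<delta>" "poly S 0 \<noteq> 0"
      by (auto simp: polys_nonzero_const_def)
    \<comment> \<open>Otherwise \<open>Q\<close> is divisible by x, hence equal to x and of degree
      1, whereas 0 < \<delta> < r forces \<open>r\<close> to be at least 2.\<close>
    have "poly Q 0 \<noteq> 0"
    proof
      assume "poly Q 0 = 0"
      then have "[:0, 1:] dvd Q" by (simp add: poly_eq_0_iff_dvd)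
      then obtain c where c: "Q = [:0, 1:] * c" by (auto elim: dvdE)
      then have "[:0, 1 :: bit:] dvd 1 \<or> c dvd 1"
        by (rule irreducibleD[OF Q(1)])
      moreover have "\<not> [:0, 1 :: bit:] dvd 1"
        by (simp add: is_unit_iff_degree)
      ultimately have "c = 1"
        by (simp add: is_unit_bit_poly)
      with c Q assms show False by simp
    qed
    moreover have "Q \<noteq> 0" "S \<noteq> 0" using Q S by auto
    ultimately show "P \<in> {P \<in> polys_nonzero_const (r + \<delta>). almost_irreducible_with_exponent P r}"
      using P Q S assms
      by (auto simp: polys_nonzero_const_def almost_irreducible_with_exponent_def degree_mult_eq
          intro!: exI[of _ Q])
  qed
  then show ?thesis
    by (simp add: card_image[OF inj] card_cartesian_product card_polys_nonzero_const[OF assms(1)]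
        num_irreducible_def)
qed

text \<open>The dependence on \<delta> cancels: the count of cofactors and the size of the sample
  space differ by a factor \<open>2 ^ r\<close>.\<close>

lemma prob_almost_irreducible:
  assumes "0 < \<delta>" "\<delta> < r"
  shows "measure_pmf.prob (pmf_of_set (polys_nonzero_const (r + \<delta>)))
      {P. almost_irreducible_with_exponent P r} = num_irreducible r / 2 ^ r"
proof -
  let ?A = "polys_nonzero_const (r + \<delta>)"
  have card: "card ?A = 2 ^ (r + \<delta> - 1)"
    using assms by (intro card_polys_nonzero_const) auto
  then have "finite ?A" "?A \<noteq> {}"
    by (auto intro: card_ge_0_finite)
  then have "measure_pmf.prob (pmf_of_set ?A) {P. almost_irreducible_with_exponent P r} =
      card (?A \<inter> {P. almost_irreducible_with_exponent P r}) / card ?A"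
    by (simp add: measure_pmf_of_set)
  also have "?A \<inter> {P. almost_irreducible_with_exponent P r} =
      {P \<in> ?A. almost_irreducible_with_exponent P r}"
    by auto
  also have "real (card \<dots>) / card ?A = num_irreducible r * 2 ^ (\<delta> - 1) / 2 ^ (r + \<delta> - 1)"
    by (simp add: card_almost_irreducible[OF assms] card)
  also have "r + \<delta> - 1 = r + (\<delta> - 1)" using assms by simp
  finally show ?thesis by (simp add: power_add)
qed

theorem corollary9p2:
  shows "\<exists>C::real. \<forall>r \<delta> n :: nat. 0 < \<delta> \<and> \<delta> < r \<and> n = r + \<delta> \<longrightarrow>
    (\<exists>\<epsilon>::real. \<bar>\<epsilon>\<bar> \<le> C * 2 powr (- real r / 2) \<and>
      measure_pmf.prob (pmf_of_set (polys_nonzero_const n))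
          {P. almost_irreducible_with_exponent P r}
        = 1 / real r * (1 + \<epsilon>))"
proof (rule exI[of _ 2], intro allI impI, elim conjE)
  fix r \<delta> n :: nat
  assume d: "0 < \<delta>" "\<delta> < r" and n: "n = r + \<delta>"
  \<comment> \<open>The witness for \<epsilon> is \<open>N / 2 ^ r - 1\<close>, and the constant 2
    is the factor of \<open>2 ^ (r div 2)\<close> in \<open>num_irreducible_ge\<close>.\<close>
  define N where "N = real (r * num_irreducible r)"
  have "r > 0" using d by simp
  have up: "N \<le> 2 ^ r"
    using num_irreducible_le[OF \<open>r > 0\<close>] unfolding N_def by (metis of_nat_le_iff of_nat_numeral of_nat_power)
  have lo: "2 ^ r \<le> N + 2 * 2 ^ (r div 2)"
    using of_nat_mono[OF num_irreducible_ge[OF \<open>r > 0\<close>], where ?'a = real] by (simp add: N_def)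
  have "(2::real) ^ (r div 2) = 2 powr real (r div 2)"
    by (simp add: powr_realpow)
  also have "\<dots> \<le> 2 powr (real r / 2)"
    by (intro powr_mono) linarith+
  finally have half: "(2::real) ^ (r div 2) \<le> 2 powr (real r / 2)" .
  \<comment> \<open>Pulling out \<open>2 ^ r\<close> turns the absolute error of \<open>N\<close>
    into a relative one.\<close>
  have "(2::real) powr (real r / 2) = 2 powr real r * 2 powr (- real r / 2)"
    by (simp flip: powr_add)
  then have "(2::real) powr (real r / 2) = 2 ^ r * 2 powr (- real r / 2)"
    by (simp add: powr_realpow)
  with up lo half have "\<bar>N - 2 ^ r\<bar> \<le> 2 * 2 powr (- real r / 2) * 2 ^ r"
    by (simp add: mult_ac)
  then have "\<bar>N / 2 ^ r - 1\<bar> \<le> 2 * 2 powr (- real r / 2)"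
    by (simp add: abs_le_iff field_simps)
  moreover have "measure_pmf.prob (pmf_of_set (polys_nonzero_const n))
      {P. almost_irreducible_with_exponent P r} = 1 / real r * (1 + (N / 2 ^ r - 1))"
    using prob_almost_irreducible[OF d] \<open>r > 0\<close> by (simp add: n N_def)
  ultimately show "\<exists>\<epsilon>::real. \<bar>\<epsilon>\<bar> \<le> 2 * 2 powr (- real r / 2) \<and>
      measure_pmf.prob (pmf_of_set (polys_nonzero_const n))
          {P. almost_irreducible_with_exponent P r} = 1 / real r * (1 + \<epsilon>)"
    by blast
qed

end
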